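(* Let $N>2$, let $\alpha_\mu<0$ for $0<\mu<N$ be fixed, put $|\alpha_\tau|:=\min_{0<\mu<N}|\alpha_\mu|$ and $\alpha_{(c)}:=\big(\sum_{\mu=1}^{N-1}|\alpha_\mu|^{-1}\big)^{-1}$. For $\alpha_{(c)}<\alpha_0<|\alpha_\tau|$ let $\Psi(\alpha_0)$ be the unique solution in $(0,\pi)$ of $$\Psi=\sum_{\mu=1}^{N-1}\arcsin\Big(\frac{\alpha_0}{|\alpha_\mu|}\sin\Psi\Big),$$ and let $\beta(\alpha_0)=\alpha_0\sin\Psi(\alpha_0)$. Put $$A:=\frac16\Big(1-\alpha_{(c)}^3\sum_{\mu=1}^{N-1}|\alpha_\mu|^{-3}\Big).$$ Then, writing $\alpha_0=\alpha_{(c)}+\epsilon$ with $\epsilon>0$, $\epsilon\to0$, $$\Psi=\frac{\sqrt{\epsilon}}{\sqrt{A\,\alpha_{(c)}}}+O(\epsilon^{3/2}),\qquad \beta=\alpha_{(c)}\,\frac{\sqrt{\epsilon}}{\sqrt{A\,\alpha_{(c)}}}+O(\epsilon^{3/2}).$$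
   Context: Here $\alpha_{(c)}<|\alpha_\tau|$, and the displayed fixed-point equation has exactly one solution in $(0,\pi)$ for each $\alpha_0$ with $\alpha_{(c)}<\alpha_0<|\alpha_\tau|$, so $\Psi(\alpha_0)$ is well defined. *)

theory Defs
  imports Complex_Main "HOL-Library.Landau_Symbols"
begin

definition abs_alpha_tau :: "nat \<Rightarrow> (nat \<Rightarrow> real) \<Rightarrow> real" where
  "abs_alpha_tau N \<alpha> = Min ((\<lambda>\<mu>. \<bar>\<alpha> \<mu>\<bar>) ` {0<..<N})"

definition alpha_c :: "nat \<Rightarrow> (nat \<Rightarrow> real) \<Rightarrow> real" where
  "alpha_c N \<alpha> = inverse (\<Sum>\<mu>=1..N-1. inverse \<bar>\<alpha> \<mu>\<bar>)"

definition coeff_A :: "nat \<Rightarrow> (nat \<Rightarrow> real) \<Rightarrow> real" where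
  "coeff_A N \<alpha> = 1/6 * (1 - alpha_c N \<alpha> ^ 3 * (\<Sum>\<mu>=1..N-1. inverse (\<bar>\<alpha> \<mu>\<bar> ^ 3)))"

definition is_phase_solution :: "nat \<Rightarrow> (nat \<Rightarrow> real) \<Rightarrow> real \<Rightarrow> real \<Rightarrow> bool" where
  "is_phase_solution N \<alpha> \<alpha>0 \<psi> \<longleftrightarrow>
     0 < \<psi> \<and> \<psi> < pi \<and> \<psi> = (\<Sum>\<mu>=1..N-1. arcsin (\<alpha>0 / \<bar>\<alpha> \<mu>\<bar> * sin \<psi>))"

end

(* With S = sum of the 1/|alpha_mu| and alpha_0 = alpha_c + e, Taylor expansion of the right-hand side
   minus the left-hand side of the fixed-point equation gives psi * (S e - A psi^2 + O(e^2)), uniformly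
   for psi^2 = O(e).  Hence this difference changes sign between the points with
   psi^2 = S e / A -+ M e^2, and the root found there is Psi because the root in (0, pi) is unique.
   Extracting square roots turns the error O(e^2) in psi^2 into O(e^(3/2)) in psi. *)
theory Submission
  imports Defs
begin

section \<open>Taylor bounds for arcsin and sin with explicit remainders\<close>

text \<open>Integrate from 0 the bounds \<open>1 + y^2/2\<close> and \<open>1 + y^2/2 + y^4\<close>
  on the derivative \<open>1 / sqrt (1 - y^2)\<close>. The constant 1/5 is that of the
  antiderivative of \<open>y^4\<close>, cruder than the Taylor coefficient 3/40.\<close>

lemma arcsin_cubic_bounds:
  fixes x :: real
  assumes "0 \<le> x" "x \<le> 1/2"
  shows "x + x^3/6 \<le> arcsin x" "arcsin x \<le> x + x^3/6 + x^5/5"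
proof -
  have d: "((\<lambda>x. arcsin x - (x + x^3/6)) has_real_derivative (inverse (sqrt (1-y^2)) - (1 + y^2/2))) (at y)"
       "((\<lambda>x. x + x^3/6 + x^5/5 - arcsin x) has_real_derivative (1 + y^2/2 + y^4 - inverse (sqrt (1-y^2)))) (at y)"
       and s: "1 + y^2/2 \<le> inverse (sqrt (1-y^2))" "inverse (sqrt (1-y^2)) \<le> 1 + y^2/2 + y^4"
    if y: "0 \<le> y" "y \<le> 1/2" for y :: real
  proof -
    show "((\<lambda>x. arcsin x - (x + x^3/6)) has_real_derivative (inverse (sqrt (1-y^2)) - (1 + y^2/2))) (at y)"
      using y by (auto intro!: derivative_eq_intros simp: power2_eq_square)
    show "((\<lambda>x. x + x^3/6 + x^5/5 - arcsin x) has_real_derivative (1 + y^2/2 + y^4 - inverse (sqrt (1-y^2)))) (at y)"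
      using y by (auto intro!: derivative_eq_intros simp: power2_eq_square)
    define z where "z = y^2"
    have "y^2 \<le> (1/2)^2" using y by (intro power_mono) auto
    then have z: "0 \<le> z" "z \<le> 1/4" by (auto simp: z_def power2_eq_square)
    have y4: "y^4 = z^2" by (simp add: z_def flip: power_mult)
    \<comment> \<open>In \<open>z = y^2\<close>, each bound on the derivative becomes polynomial
      after multiplying by \<open>sqrt (1-z)\<close> and squaring. Only the comparison of the
      resulting product with 1 remains.\<close>
    have "(1 + z/2)^2 * (1-z) = 1 - z^2 * (3/4 + z/4)"
      by (simp add: power2_eq_square field_simps)
    also have "\<dots> \<le> 1" using z by simp
    finally have "sqrt ((1 + z/2)^2 * (1-z)) \<le> 1" by simp
    then have "(1 + z/2) * sqrt (1-z) \<le> 1"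
      using z by (simp add: real_sqrt_mult)
    moreover have "sqrt (1-z) > 0" using z by simp
    ultimately show "1 + y^2/2 \<le> inverse (sqrt (1-y^2))"
      by (simp add: z_def field_simps)
    have "z^3 \<le> 1^3" using z by (intro power_mono) auto
    then have "z^2 * (5/4 * (1-z) - z^3) \<ge> z^2 * 0"
      using z power_mono[of z "1/4" 3] by (intro mult_left_mono) (auto simp: power_divide)
    then have "1 \<le> 1 + z^2 * (5/4 * (1-z) - z^3)" by simp
    also have "\<dots> = (1 + z/2 + z^2)^2 * (1-z)"
      by (simp add: power2_eq_square power3_eq_cube field_simps)
    finally have "1 \<le> sqrt ((1 + z/2 + z^2)^2 * (1-z))" by simp
    also have "\<dots> = (1 + z/2 + z^2) * sqrt (1-z)" using z by (simp add: real_sqrt_mult)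
    finally show "inverse (sqrt (1-y^2)) \<le> 1 + y^2/2 + y^4"
      using z \<open>sqrt (1-z) > 0\<close> by (simp add: y4 field_simps flip: z_def)
  qed
  have "arcsin 0 - (0 + 0^3/6) \<le> arcsin x - (x + x^3/6)"
    using assms by (intro DERIV_nonneg_imp_nondecreasing[of 0 x "\<lambda>x. arcsin x - (x + x^3/6)"])
      (auto intro!: exI d(1) s(1))
  then show "x + x^3/6 \<le> arcsin x" by simp
  have "0 + 0^3/6 + 0^5/5 - arcsin 0 \<le> x + x^3/6 + x^5/5 - arcsin x"
    using assms by (intro DERIV_nonneg_imp_nondecreasing[of 0 x "\<lambda>x. x + x^3/6 + x^5/5 - arcsin x"])
      (auto intro!: exI d(2) s(2))
  then show "arcsin x \<le> x + x^3/6 + x^5/5" by simp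
qed

text \<open>Starting from \<open>sin x \<le> x\<close>, repeated integration from 0 bounds cos and
  sin alternately, from below and from above.\<close>

lemma sin_quintic_bounds:
  fixes x :: real
  assumes "0 \<le> x"
  shows "x - x^3/6 \<le> sin x" "sin x \<le> x - x^3/6 + x^5/120"
proof -
  have c2: "1 - x^2/2 \<le> cos x" if "0 \<le> x" for x :: real
  proof -
    have "cos 0 - (1 - 0^2/2) \<le> cos x - (1 - x^2/2)"
      using that by (intro DERIV_nonneg_imp_nondecreasing[of 0 x "\<lambda>x. cos x - (1 - x^2/2)"])
        (auto intro!: exI derivative_eq_intros simp: sin_x_le_x)
    then show ?thesis by simp
  qed
  have s3: "x - x^3/6 \<le> sin x" if "0 \<le> x" for x :: real
  proof -
    have "sin 0 - (0 - 0^3/6) \<le> sin x - (x - x^3/6)"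
      using that c2 by (intro DERIV_nonneg_imp_nondecreasing[of 0 x "\<lambda>x. sin x - (x - x^3/6)"])
        (force intro!: exI derivative_eq_intros simp: field_simps)+
    then show ?thesis by simp
  qed
  have c4: "cos x \<le> 1 - x^2/2 + x^4/24" if "0 \<le> x" for x :: real
  proof -
    have "1 - 0^2/2 + 0^4/24 - cos 0 \<le> 1 - x^2/2 + x^4/24 - cos x"
      using that s3 by (intro DERIV_nonneg_imp_nondecreasing[of 0 x "\<lambda>x. 1 - x^2/2 + x^4/24 - cos x"])
        (force intro!: exI derivative_eq_intros simp: field_simps)+
    then show ?thesis by simp
  qed
  have "0 - 0^3/6 + 0^5/120 - sin 0 \<le> x - x^3/6 + x^5/120 - sin x"
    using assms c4 by (intro DERIV_nonneg_imp_nondecreasing[of 0 x "\<lambda>x. x - x^3/6 + x^5/120 - sin x"])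
      (force intro!: exI derivative_eq_intros simp: field_simps)+
  then show "sin x \<le> x - x^3/6 + x^5/120" by simp
  show "x - x^3/6 \<le> sin x" using s3 assms .
qed

text \<open>The cubic term combines \<open>-k p^3/6\<close> from sin with \<open>k^3 p^3/6\<close>
  from arcsin. The remainder constant does not depend on \<open>k\<close>, which later gives
  uniformity in the coupling.\<close>

lemma arcsin_mult_sin_expansion:
  fixes k p :: real
  assumes k: "0 \<le> k" "k \<le> 1" and p: "0 \<le> p" "p \<le> 1/2"
  shows "\<bar>arcsin (k * sin p) - k * p + (k - k^3) / 6 * p^3\<bar> \<le> p^5"
proof -
  define s where "s = sin p"
  have s: "0 \<le> s" "s \<le> p" "p - p^3/6 \<le> s" "s \<le> p - p^3/6 + p^5/120"
    using p pi_ge_two sin_quintic_bounds[of p] unfolding s_def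
    by (auto intro!: sin_ge_zero sin_x_le_x)
  define x where "x = k * s"
  have x: "0 \<le> x" "x \<le> s" using k s by (auto simp: x_def mult_left_le_one_le)
  have ar: "x + x^3/6 \<le> arcsin x" "arcsin x \<le> x + x^3/6 + x^5/5"
    using arcsin_cubic_bounds[OF x(1)] order_trans[OF x(2) order_trans[OF s(2) p(2)]] by blast+
  have x5: "x^5 \<le> p^5" using x s by (intro power_mono) auto
  have p5: "0 \<le> p^5" using p by simp
  have k3: "0 \<le> k^3" "k^3 \<le> 1" using k by (auto simp: power_le_one)
  have "p^3 - s^3 = (p - s) * (p^2 + p*s + s^2)"
    by (simp add: power2_eq_square power3_eq_cube algebra_simps)
  also have "\<dots> \<le> (p^3/6) * (p^2 + p*p + p^2)"
    using s p by (intro mult_mono add_mono mult_left_mono power_mono) auto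
  also have "\<dots> = p^5/2" by (simp add: power_numeral_reduce algebra_simps)
  finally have d1: "p^3 - s^3 \<le> p^5/2" .
  have d0: "s^3 \<le> p^3" using s by (intro power_mono)
  have d2: "0 \<le> k^3 * (p^3 - s^3)" "k^3 * (p^3 - s^3) \<le> p^5/2"
    using d0 d1 k3 mult_mono[of "k^3" 1 "p^3 - s^3" "p^5/2"] by auto
  have d3: "0 \<le> k * (s - (p - p^3/6))" "k * (s - (p - p^3/6)) \<le> p^5/120"
    using s k p5 mult_mono[of k 1 "s - (p - p^3/6)" "p^5/120"] by auto
  \<comment> \<open>Three errors: truncating arcsin, truncating sin, and replacing
    \<open>sin p\<close> by \<open>p\<close> in the cubic term. They are at most 1/5, 1/120 and 1/12
    times \<open>p^5\<close>.\<close>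
  have "arcsin x - k * p + (k - k^3) / 6 * p^3
      = (arcsin x - x - x^3/6) + k * (s - (p - p^3/6)) - k^3 * (p^3 - s^3) / 6"
    by (simp add: x_def power_mult_distrib field_simps)
  then show ?thesis using ar d2 d3 x5 p5 unfolding x_def s_def by linarith
qed

lemma sum_arcsin_mult_sin_expansion:
  fixes k :: "'a \<Rightarrow> real" and p :: real
  assumes k: "\<And>i. i \<in> I \<Longrightarrow> 0 \<le> k i" "\<And>i. i \<in> I \<Longrightarrow> k i \<le> 1" and p: "0 \<le> p" "p \<le> 1/2"
  shows "\<bar>(\<Sum>i\<in>I. arcsin (k i * sin p)) - (\<Sum>i\<in>I. k i) * p
           + ((\<Sum>i\<in>I. k i) - (\<Sum>i\<in>I. k i ^ 3)) / 6 * p^3\<bar> \<le> card I * p^5"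
proof -
  have "(\<Sum>i\<in>I. arcsin (k i * sin p)) - (\<Sum>i\<in>I. k i) * p
           + ((\<Sum>i\<in>I. k i) - (\<Sum>i\<in>I. k i ^ 3)) / 6 * p^3
      = (\<Sum>i\<in>I. arcsin (k i * sin p) - k i * p + (k i - k i^3) / 6 * p^3)"
    by (simp add: sum.distrib sum_subtractf sum_distrib_right sum_divide_distrib left_diff_distrib diff_divide_distrib)
  also have "\<bar>\<dots>\<bar> \<le> (\<Sum>i\<in>I. \<bar>arcsin (k i * sin p) - k i * p + (k i - k i^3) / 6 * p^3\<bar>)"
    by (rule sum_abs)
  also have "\<dots> \<le> (\<Sum>i\<in>I. p^5)"
    by (intro sum_mono arcsin_mult_sin_expansion k p)
  finally show ?thesis by simp
qed

section \<open>Uniqueness of the positive fixed point\<close>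

text \<open>The difference of the two sides is strictly concave on \<open>[0, \<pi>]\<close> and vanishes at \<open>0\<close>, so Rolle's
  theorem applied twice rules out two further zeros.\<close>
lemma arcsin_fixed_point_unique:
  fixes k :: "'a \<Rightarrow> real"
  assumes I: "finite I" "I \<noteq> {}" and k: "\<And>i. i \<in> I \<Longrightarrow> 0 < k i" "\<And>i. i \<in> I \<Longrightarrow> k i < 1"
    and x: "0 < x" "x < pi" "x = (\<Sum>i\<in>I. arcsin (k i * sin x))"
    and y: "0 < y" "y < pi" "y = (\<Sum>i\<in>I. arcsin (k i * sin y))"
  shows "x = y"
proof -
  define f where "f = (\<lambda>z. (\<Sum>i\<in>I. arcsin (k i * sin z)) - z)"
  define f' where "f' = (\<lambda>z. (\<Sum>i\<in>I. k i * cos z / sqrt (1 - (k i * sin z)^2)) - 1)"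
  define f'' where "f'' = (\<lambda>z. \<Sum>i\<in>I. - (k i * (1 - k i ^2) * sin z / sqrt (1 - (k i * sin z)^2) ^ 3))"
  have ks: "\<bar>k i * sin z\<bar> < 1" if "i \<in> I" for i z
  proof -
    have "\<bar>k i * sin z\<bar> = k i * \<bar>sin z\<bar>" using k(1)[OF that] by (simp add: abs_mult)
    also have "\<dots> \<le> k i * 1" using k(1)[OF that] by (intro mult_left_mono) auto
    finally show ?thesis using k(2)[OF that] by simp
  qed
  have ks2: "0 < 1 - (k i * sin z)^2" if "i \<in> I" for i z
    using ks[OF that, of z] by (simp add: abs_square_less_1)
  have d1: "(f has_real_derivative f' z) (at z)" for z
    unfolding f_def f'_def
    using ks by (auto intro!: derivative_eq_intros sum.cong simp: abs_less_iff field_simps) 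
  have d2: "(f' has_real_derivative f'' z) (at z)" for z
  proof -
    have "((\<lambda>z. k i * cos z / sqrt (1 - (k i * sin z)^2)) has_real_derivative
       - (k i * (1 - k i ^2) * sin z / sqrt (1 - (k i * sin z)^2) ^ 3)) (at z)" if i: "i \<in> I" for i
    proof -
      define r where "r = sqrt (1 - (k i * sin z)^2)"
      have r: "r > 0" "r^2 = 1 - (k i * sin z)^2" using ks2[OF i, of z] by (auto simp: r_def)
      have "((\<lambda>z. k i * cos z / sqrt (1 - (k i * sin z)^2)) has_real_derivative
        ((- (k i * sin z)) * r - k i * cos z * (- (2 * (k i * sin z) * (k i * cos z)) * (inverse r / 2))) / (r * r)) (at z)"
        using ks2[OF i, of z] r
        by (auto intro!: derivative_eq_intros simp: r_def)
      also have "((- (k i * sin z)) * r - k i * cos z * (- (2 * (k i * sin z) * (k i * cos z)) * (inverse r / 2))) / (r * r)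
         = (- (k i * sin z) * r^2 + k i ^2 * (cos z)^2 * (k i * sin z)) / r^3"
        using r(1) by (simp add: field_simps power2_eq_square power3_eq_cube)
      \<comment> \<open>With cos eliminated, the terms cubic in \<open>sin z\<close> cancel. The
        remaining factor \<open>1 - k i ^2\<close> is positive, which fixes the sign of the second
        derivative.\<close>
      also have "(cos z)^2 = 1 - (sin z)^2" by (simp add: cos_squared_eq)
      also have "(- (k i * sin z) * r^2 + k i ^2 * (1 - (sin z)^2) * (k i * sin z)) / r^3
         = - (k i * (1 - k i ^2) * sin z / r ^ 3)"
        unfolding r(2) by (simp add: algebra_simps power2_eq_square add_divide_distrib diff_divide_distrib)
      finally show ?thesis by (simp add: r_def)
    qed
    then have "(f' has_real_derivative f'' z - 0) (at z)"
      unfolding f'_def f''_def by (intro DERIV_diff DERIV_sum DERIV_const)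
    then show ?thesis by simp
  qed
  have neg: "f'' z < 0" if "0 < z" "z < pi" for z
  proof -
    have "0 < k i * (1 - k i ^2) * sin z / sqrt (1 - (k i * sin z)^2) ^ 3" if i: "i \<in> I" for i
      using ks2[OF i, of z] k[OF i] sin_gt_zero[OF \<open>0 < z\<close> \<open>z < pi\<close>]
      by (intro divide_pos_pos mult_pos_pos) (auto simp: power_less_one_iff)
    then have "0 < (\<Sum>i\<in>I. k i * (1 - k i ^2) * sin z / sqrt (1 - (k i * sin z)^2) ^ 3)"
      using I by (intro sum_pos) auto
    then show ?thesis unfolding f''_def by (simp add: sum_negf)
  qed
  have rolle: "\<exists>w. u < w \<and> w < v \<and> g' w = 0"
    if "u < v" "g u = g v" "\<And>z. (g has_real_derivative g' z) (at z)" for u v :: real and g g' :: "real \<Rightarrow> real"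
    using MVT2[of u v g g'] that by auto
  have no: False if h: "0 < u" "u < v" "v < pi" "f u = 0" "f v = 0" for u v
  proof -
    have "f 0 = 0" by (simp add: f_def)
    then obtain w1 where w1: "0 < w1" "w1 < u" "f' w1 = 0" using rolle[of 0 u f f'] h d1 by auto
    obtain w2 where w2: "u < w2" "w2 < v" "f' w2 = 0" using rolle[of u v f f'] h d1 by auto
    obtain w where "w1 < w" "w < w2" "f'' w = 0" using rolle[of w1 w2 f' f''] w1 w2 d2 by auto
    then show False using neg[of w] w1 w2 h by auto
  qed
  have "f x = 0" "f y = 0" using x(3) y(3) by (auto simp: f_def)
  then show ?thesis using no[of x y] no[of y x] x y by (cases x y rule: linorder_cases) auto
qed

section \<open>Existence of a fixed point near the predicted place\<close>

text \<open>Compare termwise, \<open>c i ^ 3 < S^2 * c i\<close> with \<open>S\<close> the sum. For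
  \<open>a = inverse S\<close> this is exactly the positivity of the coefficient
  \<open>A\<close>.\<close>

lemma sum_power3_less:
  fixes c :: "'a \<Rightarrow> real"
  assumes "finite I" "I \<noteq> {}" "\<And>i. i \<in> I \<Longrightarrow> 0 < c i" "\<And>i. i \<in> I \<Longrightarrow> c i < (\<Sum>i\<in>I. c i)"
  shows "(\<Sum>i\<in>I. c i ^ 3) < (\<Sum>i\<in>I. c i) ^ 3"
proof -
  let ?S = "\<Sum>i\<in>I. c i"
  have "c i ^ 3 < ?S ^ 2 * c i" if "i \<in> I" for i
    using assms(3,4)[OF that] power_strict_mono[of "c i" ?S 2]
    by (simp add: power3_eq_cube power2_eq_square)
  then have "(\<Sum>i\<in>I. c i ^ 3) < (\<Sum>i\<in>I. ?S ^ 2 * c i)"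
    using assms by (intro sum_strict_mono) auto
  also have "\<dots> = ?S ^ 3" by (simp add: sum_distrib_left[symmetric] power3_eq_cube power2_eq_square)
  finally show ?thesis .
qed

text \<open>Here \<open>c i\<close> stands for the inverse of an
  \<open>\<bar>\<alpha> i\<bar>\<close> and \<open>a\<close> for the critical coupling. The estimate
  concerns \<open>p^2\<close> because, after division by \<open>p\<close>, the leading part
  \<open>S * e - A * p^2\<close> of the equation is linear in \<open>p^2\<close> and
  \<open>e\<close>.\<close>

lemma arcsin_fixed_point_asymptotics:
  fixes c :: "'a \<Rightarrow> real" and I :: "'a set"
  defines "S \<equiv> \<Sum>i\<in>I. c i"
  defines "T \<equiv> \<Sum>i\<in>I. c i ^ 3"
  defines "a \<equiv> inverse S"
  defines "A \<equiv> 1/6 * (1 - a^3 * T)"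
  assumes I: "finite I" "I \<noteq> {}" and c: "\<And>i. i \<in> I \<Longrightarrow> 0 < c i" "\<And>i. i \<in> I \<Longrightarrow> c i < S"
  shows "\<exists>M. \<forall>\<^sub>F e in at_right 0. \<exists>p. 0 < p \<and> p < pi \<and>
           p = (\<Sum>i\<in>I. arcsin ((a + e) * c i * sin p)) \<and> \<bar>p^2 - S / A * e\<bar> \<le> M * e^2"
proof -
  have S: "S > 0" unfolding S_def using I c by (intro sum_pos) auto
  have a: "a > 0" "a * S = 1" using S by (auto simp: a_def)
  have T: "T > 0" unfolding T_def using I c by (intro sum_pos) auto
  have "T < S^3" using sum_power3_less[of I c] I c by (auto simp: S_def T_def)
  then have A: "A > 0" using S by (simp add: A_def a_def field_simps)
  define n :: real where "n = card I"
  have n: "n > 0" using I by (auto simp: n_def card_gt_0_iff)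
  define q where "q = S / A"
  have q: "q > 0" using S A by (simp add: q_def)
  \<comment> \<open>The points tested below satisfy \<open>p^2 \<le> D * e\<close>, since they
    deviate from \<open>q * e\<close> by at most \<open>M * e^2 < e\<close>.\<close>
  define D where "D = q + 1"
  \<comment> \<open>The first summand bounds the change of the cubic coefficient with
    \<open>e\<close>, the second the quintic remainders through
    \<open>p^4 \<le> D^2 * e^2\<close>.\<close>
  define K where "K = D * (S + (3*a^2 + 3*a + 1) * T) / 6 + n * D^2"
  have D: "D > 0" using q by (simp add: D_def)
  have K: "K > 0" unfolding K_def using D S T n a
    by (intro add_pos_pos divide_pos_pos mult_pos_pos) auto
  \<comment> \<open>Chosen so that at \<open>p^2 = q * e \<plusminus> M * e^2\<close> the main term
    \<open>S * e - A * p^2\<close> has size \<open>2 * K * e^2\<close>, twice the error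
    bound.\<close>
  define M where "M = 2 * K / A"
  have M: "M > 0" using K A by (simp add: M_def)
  define F where "F = (\<lambda>e p. (\<Sum>i\<in>I. arcsin ((a + e) * c i * sin p)) - p)"
  have bound: "\<bar>F e p - p * (S * e - A * p^2)\<bar> \<le> p * (K * e^2)"
    if e: "0 < e" "e \<le> 1" and k: "\<And>i. i \<in> I \<Longrightarrow> (a + e) * c i \<le> 1"
      and p: "0 \<le> p" "p \<le> 1/2" "p^2 \<le> D * e" for e p
  proof -
    have "\<bar>(\<Sum>i\<in>I. arcsin ((a + e) * c i * sin p)) - (\<Sum>i\<in>I. (a + e) * c i) * p
           + ((\<Sum>i\<in>I. (a + e) * c i) - (\<Sum>i\<in>I. ((a + e) * c i) ^ 3)) / 6 * p^3\<bar> \<le> card I * p^5"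
      using e a k p c by (intro sum_arcsin_mult_sin_expansion mult_nonneg_nonneg) (auto intro: less_imp_le)
    also have "(\<Sum>i\<in>I. (a + e) * c i) = (a + e) * S" by (simp add: S_def sum_distrib_left)
    also have "(\<Sum>i\<in>I. ((a + e) * c i) ^ 3) = (a + e)^3 * T"
      by (simp add: T_def sum_distrib_left power_mult_distrib)
    finally have 1: "\<bar>F e p + p - (a + e) * S * p + ((a + e) * S - (a + e)^3 * T) / 6 * p^3\<bar> \<le> n * p^5"
      by (simp add: F_def n_def)
    \<comment> \<open>As \<open>a * S = 1\<close>, the cubic coefficient
      \<open>((a + e) * S - (a + e)^3 * T) / 6\<close> equals \<open>A + e * G / 6\<close>.\<close>
    define G where "G = S - (3*a^2 + 3*a*e + e^2) * T"
    have "(a + e) * S * p - p - ((a + e) * S - (a + e)^3 * T) / 6 * p^3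
       = p * (S * e - A * p^2) - e * p^3 / 6 * G + (a * S - 1) * (p - p^3/6)"
      unfolding A_def G_def by (simp add: power2_eq_square power3_eq_cube field_simps)
    then have 2: "F e p - p * (S * e - A * p^2) = 
       (F e p + p - (a + e) * S * p + ((a + e) * S - (a + e)^3 * T) / 6 * p^3) - e * p^3 / 6 * G"
      using a by simp
    have "(3*a^2 + 3*a*e + e^2) * T \<le> (3*a^2 + 3*a + 1) * T"
      using e a T by (intro mult_right_mono add_mono) (auto simp: power_le_one)
    moreover have "0 \<le> (3*a^2 + 3*a*e + e^2) * T" using e a T by simp
    ultimately have G: "\<bar>G\<bar> \<le> S + (3*a^2 + 3*a + 1) * T" (is "_ \<le> ?G")
      unfolding G_def using S by linarith
    have "\<bar>e * p^3 / 6 * G\<bar> = (e * p / 6 * p^2) * \<bar>G\<bar>"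
      using e p by (simp add: abs_mult power2_eq_square power3_eq_cube)
    also have "\<dots> \<le> (e * p / 6 * (D * e)) * ?G"
      using e p G D by (intro mult_mono mult_left_mono) auto
    finally have 3: "\<bar>e * p^3 / 6 * G\<bar> \<le> p * (D * ?G / 6 * e^2)"
      by (simp add: power2_eq_square algebra_simps)
    have "n * p^5 = n * p * (p^2)^2" by (simp add: power_numeral_reduce)
    also have "\<dots> \<le> n * p * (D * e)^2"
      using p n by (intro mult_left_mono power_mono) auto
    finally have 4: "n * p^5 \<le> p * (n * D^2 * e^2)" by (simp add: power_mult_distrib mult_ac)
    have "\<bar>F e p - p * (S * e - A * p^2)\<bar> \<le> p * (n * D^2 * e^2) + p * (D * ?G / 6 * e^2)"
      using 1 2 3 4 by linarith
    also have "\<dots> = p * (K * e^2)" unfolding K_def by (simp add: algebra_simps)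
    finally show ?thesis .
  qed
  \<comment> \<open>In order, the bounds make the lower endpoint positive, give
    \<open>M * e^2 < e\<close>, give \<open>e \<le> 1\<close>, keep the endpoints at most 1/2, and
    ensure \<open>(a + e) * c i < 1\<close>.\<close>
  define e0 where "e0 = Min ({q / (2 * M), 1 / M, 1, 1 / (4 * D)} \<union> (\<lambda>i. (S - c i) * a / c i) ` I)"
  have e0: "x < e0 \<longleftrightarrow> x < q / (2 * M) \<and> x < 1 / M \<and> x < 1 \<and> x < 1 / (4 * D)
      \<and> (\<forall>i\<in>I. x < (S - c i) * a / c i)" for x
    unfolding e0_def using I by (subst Min_gr_iff) (auto simp del: less_divide_eq_1 less_divide_eq divide_less_eq)
  have "0 < (S - c i) * a / c i" if "i \<in> I" for i
    using c[OF that] a by simp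
  then have "e0 > 0" unfolding e0 using q M D by simp
  have "\<exists>p. 0 < p \<and> p < pi \<and> p = (\<Sum>i\<in>I. arcsin ((a + e) * c i * sin p)) \<and> \<bar>p^2 - S / A * e\<bar> \<le> M * e^2"
    if e: "0 < e" "e < e0" for e
  proof -
    have e1: "e < q / (2 * M)" "e < 1 / M" "e < 1" "e < 1 / (4 * D)" "\<And>i. i \<in> I \<Longrightarrow> e < (S - c i) * a / c i"
      using e(2) unfolding e0 by blast+
    have k: "(a + e) * c i < 1" if "i \<in> I" for i
    proof -
      have "e * c i < (S - c i) * a" using e1(5)[OF that] c(1)[OF that] by (simp add: field_simps)
      then show ?thesis using a(2) by (simp add: algebra_simps)
    qed
    have Me: "M * e^2 < e" "M * e^2 < q * e / 2" 
      using e1(1,2) e M by (auto simp: field_simps power2_eq_square)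
    have b: "\<bar>F e (sqrt r) - sqrt r * (S * e - A * r)\<bar> \<le> sqrt r * (K * e^2)"
         "0 < r" "0 < sqrt r" "sqrt r \<le> 1/2"
      if r: "\<bar>r - q * e\<bar> \<le> M * e^2" for r
    proof -
      have "q * e > 0" using q e by simp
      then show "r > 0" using r Me by linarith
      then show "sqrt r > 0" by simp
      have rD: "r \<le> D * e" using r Me unfolding D_def distrib_right by linarith
      also have "\<dots> \<le> 1/4" using e1(4) D by (simp add: field_simps)
      finally have "sqrt r \<le> sqrt ((1/2)^2)" by (simp add: power2_eq_square)
      then show h: "sqrt r \<le> 1/2" by (simp del: real_sqrt_power)
      show "\<bar>F e (sqrt r) - sqrt r * (S * e - A * r)\<bar> \<le> sqrt r * (K * e^2)"
        using bound[of e "sqrt r"] e e1 k h rD \<open>r > 0\<close> by (auto intro: less_imp_le)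
    qed
    \<comment> \<open>These are the squares of the endpoints for the intermediate value theorem:
      \<open>F e\<close> is nonnegative at \<open>sqrt l\<close> and nonpositive at
      \<open>sqrt u\<close>.\<close>
    define l u where "l = q * e - M * e^2" and "u = q * e + M * e^2"
    have lu: "\<bar>l - q * e\<bar> \<le> M * e^2" "\<bar>u - q * e\<bar> \<le> M * e^2" "l \<le> u"
      using M by (auto simp: l_def u_def)
    have sgn: "S * e - A * l = 2 * K * e^2" "S * e - A * u = - 2 * K * e^2"
      using A by (auto simp: l_def u_def q_def M_def field_simps)
    have "F e (sqrt l) \<ge> sqrt l * (K * e^2)"
      using b(1)[OF lu(1)] unfolding sgn by (auto simp: abs_le_iff algebra_simps)
    moreover have "sqrt l * (K * e^2) \<ge> 0" using b(3)[OF lu(1)] K by simp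
    ultimately have Fl: "F e (sqrt l) \<ge> 0" by linarith
    have "F e (sqrt u) \<le> - (sqrt u * (K * e^2))"
      using b(1)[OF lu(2)] unfolding sgn by (auto simp: abs_le_iff algebra_simps)
    moreover have "sqrt u * (K * e^2) \<ge> 0" using b(3)[OF lu(2)] K by simp
    ultimately have Fu: "F e (sqrt u) \<le> 0" by linarith
    have ks: "\<bar>(a + e) * c i * sin z\<bar> \<le> 1" if "i \<in> I" for i z
    proof -
      have "\<bar>(a + e) * c i\<bar> * \<bar>sin z\<bar> \<le> 1 * 1"
        using k[OF that] c(1)[OF that] a e by (intro mult_mono) (auto simp: abs_mult)
      then show ?thesis by (simp add: abs_mult)
    qed
    have "continuous_on {sqrt l..sqrt u} (F e)"
      unfolding F_def using ks by (auto intro!: continuous_intros simp: abs_le_iff minus_le_iff)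
    then obtain p where p: "sqrt l \<le> p" "p \<le> sqrt u" "F e p = 0"
      using IVT2'[of "F e" "sqrt u" 0 "sqrt l"] Fl Fu lu(3) by auto
    have "0 \<le> sqrt l" "0 \<le> p" using p b(3)[OF lu(1)] by linarith+
    then have "(sqrt l)^2 \<le> p^2" "p^2 \<le> (sqrt u)^2"
      using p by (intro power_mono; simp)+
    then have "l \<le> p^2" "p^2 \<le> u" using b(2)[OF lu(1)] b(2)[OF lu(2)] by auto
    then have "\<bar>p^2 - S / A * e\<bar> \<le> M * e^2" by (auto simp: l_def u_def q_def abs_le_iff)
    moreover have "0 < p" using p b(3)[OF lu(1)] by linarith
    moreover have "p < pi" using p b(4)[OF lu(2)] pi_ge_two by linarith
    ultimately show ?thesis using p(3) by (auto simp: F_def)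
  qed
  then show ?thesis
    using \<open>e0 > 0\<close> unfolding eventually_at_right_field by blast
qed

section \<open>From the squared estimate to the expansions of \<open>\<Psi>\<close> and
  \<open>\<beta>\<close>\<close>

text \<open>Divide \<open>p^2 - x\<close> by \<open>p + sqrt x\<close>, which is at least
  \<open>sqrt x\<close>. With \<open>x\<close> of order \<open>e\<close> and \<open>d\<close> of
  order \<open>e^2\<close> the result has order \<open>e^(3/2)\<close>.\<close>

lemma abs_sqrt_diff_le:
  fixes p x d :: real
  assumes "0 < p" "0 < x" "\<bar>p^2 - x\<bar> \<le> d"
  shows "\<bar>p - sqrt x\<bar> \<le> d / sqrt x"
proof -
  have s: "sqrt x > 0" "(sqrt x)^2 = x" using assms by auto
  have "\<bar>p - sqrt x\<bar> * sqrt x \<le> \<bar>p - sqrt x\<bar> * (p + sqrt x)"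
    using assms s by (intro mult_left_mono) auto
  also have "\<dots> = \<bar>(p - sqrt x) * (p + sqrt x)\<bar>" using assms s by (simp add: abs_mult)
  also have "(p - sqrt x) * (p + sqrt x) = p^2 - x"
    by (subst s(2)[symmetric]) (simp add: power2_eq_square algebra_simps)
  finally show ?thesis using assms s by (simp add: field_simps)
qed


theorem mainTheorem10:
  fixes N :: nat and \<alpha> :: "nat \<Rightarrow> real" and \<Psi> \<beta> :: "real \<Rightarrow> real"
  assumes N: "N > 2"
    and neg: "\<And>\<mu>. 0 < \<mu> \<Longrightarrow> \<mu> < N \<Longrightarrow> \<alpha> \<mu> < 0"
    and Psi: "\<And>\<alpha>0. alpha_c N \<alpha> < \<alpha>0 \<Longrightarrow> \<alpha>0 < abs_alpha_tau N \<alpha> \<Longrightarrow>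
                \<Psi> \<alpha>0 = (THE \<psi>. is_phase_solution N \<alpha> \<alpha>0 \<psi>)"
    and beta: "\<And>\<alpha>0. alpha_c N \<alpha> < \<alpha>0 \<Longrightarrow> \<alpha>0 < abs_alpha_tau N \<alpha> \<Longrightarrow>
                \<beta> \<alpha>0 = \<alpha>0 * sin (\<Psi> \<alpha>0)"
  shows "(\<lambda>\<epsilon>. \<Psi> (alpha_c N \<alpha> + \<epsilon>) - sqrt \<epsilon> / sqrt (coeff_A N \<alpha> * alpha_c N \<alpha>))
           \<in> O[at_right 0](\<lambda>\<epsilon>. \<epsilon> powr (3/2))
       \<and> (\<lambda>\<epsilon>. \<beta> (alpha_c N \<alpha> + \<epsilon>)
              - alpha_c N \<alpha> * (sqrt \<epsilon> / sqrt (coeff_A N \<alpha> * alpha_c N \<alpha>)))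
           \<in> O[at_right 0](\<lambda>\<epsilon>. \<epsilon> powr (3/2))"
proof -
  define I where "I = {1..N-1}"
  define c where "c = (\<lambda>\<mu>. inverse \<bar>\<alpha> \<mu>\<bar>)"
  define S where "S = (\<Sum>\<mu>\<in>I. c \<mu>)"
  define a where "a = alpha_c N \<alpha>"
  define A where "A = coeff_A N \<alpha>"
  have I: "finite I" "I \<noteq> {}" "I = {0<..<N}" using N by (auto simp: I_def)
  have c0: "0 < c \<mu>" if "\<mu> \<in> I" for \<mu> using neg[of \<mu>] that by (auto simp: c_def I)
  have cS: "c \<mu> < S" if m: "\<mu> \<in> I" for \<mu>
  proof -
    \<comment> \<open>\<open>N > 2\<close> supplies an index other than \<open>\<mu>\<close>, so the
      inequality is strict. Both \<open>A > 0\<close> and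
      \<open>a < abs_alpha_tau N \<alpha>\<close> rest on this.\<close>
    have \<nu>: "(if \<mu> = 1 then 2 else 1) \<in> I - {\<mu>}" using N by (simp add: I(3))
    have "0 < (\<Sum>\<nu>\<in>I - {\<mu>}. c \<nu>)" using I \<nu> c0 by (intro sum_pos) auto
    then show ?thesis using I m by (simp add: S_def sum.remove)
  qed
  have S: "S > 0" unfolding S_def using I c0 by (intro sum_pos) auto
  have a_eq: "a = inverse S" by (simp add: a_def alpha_c_def S_def c_def I_def)
  then have a: "a > 0" using S by simp
  have A_eq: "A = 1/6 * (1 - a^3 * (\<Sum>\<mu>\<in>I. c \<mu> ^ 3))"
    by (simp add: A_def coeff_A_def a_def c_def I_def power_inverse)
  have "a^3 * (\<Sum>\<mu>\<in>I. c \<mu> ^ 3) < 1"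
    using sum_power3_less[of I c] I c0 cS S by (simp add: a_eq S_def field_simps)
  then have A: "A > 0" by (simp add: A_eq)
  define q where "q = S / A"
  have q: "q > 0" using S A by (simp add: q_def)
  \<comment> \<open>Since \<open>a = inverse S\<close>, the radicand \<open>e / (A * a)\<close> is
    \<open>q * e\<close>.\<close>
  have q_sqrt: "sqrt e / sqrt (coeff_A N \<alpha> * alpha_c N \<alpha>) = sqrt (q * e)" for e
    using S A by (simp add: q_def a_eq real_sqrt_divide[symmetric] field_simps flip: a_def A_def)
  have tau: "a < abs_alpha_tau N \<alpha>"
    unfolding abs_alpha_tau_def I(3)[symmetric]
  proof (subst Min_gr_iff)
    show "\<forall>x\<in>(\<lambda>\<mu>. \<bar>\<alpha> \<mu>\<bar>) ` I. a < x"
    proof safe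
      fix \<mu> assume m: "\<mu> \<in> I"
      have "inverse S < inverse (c \<mu>)" using cS[OF m] c0[OF m] by (intro less_imp_inverse_less)
      then show "a < \<bar>\<alpha> \<mu>\<bar>" by (simp add: c_def a_eq)
    qed
  qed (use I in auto)
  obtain M where M: "\<forall>\<^sub>F e in at_right 0. \<exists>p. 0 < p \<and> p < pi \<and>
           p = (\<Sum>i\<in>I. arcsin ((a + e) * c i * sin p)) \<and> \<bar>p^2 - q * e\<bar> \<le> M * e^2"
    using arcsin_fixed_point_asymptotics[of I c] I c0 cS
    unfolding S_def[symmetric] a_eq[symmetric] A_eq[symmetric] q_def[symmetric] by blast
  have "\<forall>\<^sub>F e in at_right 0. e < min 1 (abs_alpha_tau N \<alpha> - a)"
    using tau by (intro order_tendstoD(2)[of _ 0] tendsto_ident_at) auto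
  with M have ev: "\<forall>\<^sub>F e in at_right 0. 0 < e \<and> e < 1 \<and> 0 < \<Psi> (a + e) \<and> \<bar>\<Psi> (a + e) ^ 2 - q * e\<bar> \<le> M * e^2
      \<and> \<beta> (a + e) = (a + e) * sin (\<Psi> (a + e))"
    using eventually_at_right_less
  proof eventually_elim
    case (elim e)
    then obtain p where p: "0 < p" "p < pi" "p = (\<Sum>i\<in>I. arcsin ((a + e) * c i * sin p))"
      "\<bar>p^2 - q * e\<bar> \<le> M * e^2" by auto
    have e: "e > 0" "a + e < abs_alpha_tau N \<alpha>" using elim by auto
    have k: "0 < (a + e) * c i" "(a + e) * c i < 1" if i: "i \<in> I" for i
    proof -
      show "0 < (a + e) * c i" using a e c0[OF i] by simp
      have "abs_alpha_tau N \<alpha> \<le> \<bar>\<alpha> i\<bar>" 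
        unfolding abs_alpha_tau_def I(3)[symmetric] using I(1) i by (intro Min_le) auto
      then have "a + e < \<bar>\<alpha> i\<bar>" using e by linarith
      then show "(a + e) * c i < 1" using c0[OF i] by (simp add: c_def field_simps)
    qed
    have sol: "is_phase_solution N \<alpha> (a + e) y \<longleftrightarrow>
        0 < y \<and> y < pi \<and> y = (\<Sum>i\<in>I. arcsin ((a + e) * c i * sin y))" for y
      by (simp add: is_phase_solution_def c_def I_def divide_inverse)
    \<comment> \<open>The root from the intermediate value theorem is the only one in
      \<open>(0, pi)\<close>, so the description defining \<open>\<Psi>\<close> denotes it and the
      estimate carries over.\<close>
    have "(THE \<psi>. is_phase_solution N \<alpha> (a + e) \<psi>) = p"
      unfolding sol using p k I arcsin_fixed_point_unique[of I "\<lambda>i. (a + e) * c i"]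
      by (intro the_equality) blast+
    then have "\<Psi> (a + e) = p" using Psi[of "a + e"] e by (simp add: a_def)
    then show ?case using p elim beta[of "a + e"] e by (auto simp: a_def)
  qed
  define C1 where "C1 = M / sqrt q"
  \<comment> \<open>\<open>C\<close> is chosen so that
    \<open>\<Psi> (a + e) \<le> C * sqrt e\<close> for \<open>e < 1\<close>. The absolute value
    enters because the sign of the obtained \<open>M\<close> is not recorded.\<close>
  define C where "C = sqrt q + \<bar>M\<bar> / sqrt q"
  define C2 where "C2 = a * C1 + (a + 1) * C^3 / 6 + C"
  have est: "\<forall>\<^sub>F e in at_right 0. \<bar>\<Psi> (a + e) - sqrt (q * e)\<bar> \<le> C1 * e powr (3/2)
     \<and> \<bar>\<beta> (a + e) - a * sqrt (q * e)\<bar> \<le> C2 * e powr (3/2)"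
    using ev
  proof eventually_elim
    case (elim e)
    define p where "p = \<Psi> (a + e)"
    have e: "0 < e" "e < 1" and p: "p > 0" "\<bar>p^2 - q * e\<bar> \<le> M * e^2" and
      b: "\<beta> (a + e) = (a + e) * sin p"
      using elim by (auto simp: p_def)
    \<comment> \<open>In terms of \<open>s\<close> all half-integer powers of \<open>e\<close>
      become integer powers, in particular \<open>e powr (3/2) = s^3\<close>.\<close>
    define s where "s = sqrt e"
    have s: "s > 0" "e = s^2" "s < 1" using e by (auto simp: s_def)
    have s3: "e powr (3/2) = s^3"
    proof -
      have "e powr (3/2) = (e powr (1/2)) powr 3" using e by (simp add: powr_powr)
      then show ?thesis using e by (simp add: powr_half_sqrt s_def)
    qed
    have qs: "sqrt (q * e) = sqrt q * s" by (simp add: s_def real_sqrt_mult)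
    have "\<bar>p - sqrt (q * e)\<bar> \<le> M * e^2 / sqrt (q * e)"
      using abs_sqrt_diff_le[of p "q * e" "M * e^2"] p q e by simp
    also have "\<dots> = M / sqrt q * s^3"
      using s q unfolding qs by (simp add: power2_eq_square power3_eq_cube)
    finally have 1: "\<bar>p - sqrt (q * e)\<bar> \<le> M / sqrt q * s^3" .
    have "s^3 \<le> s^1" using s by (intro power_decreasing) auto
    then have "\<bar>M\<bar> / sqrt q * s^3 \<le> \<bar>M\<bar> / sqrt q * s" using q by (intro mult_left_mono) auto
    moreover have "M / sqrt q * s^3 \<le> \<bar>M\<bar> / sqrt q * s^3" 
      using q s by (intro mult_right_mono divide_right_mono) auto
    ultimately have pC: "p \<le> C * s" using 1 unfolding qs C_def distrib_right by linarith
    have "p^3 \<le> (C * s)^3" using pC p by (intro power_mono) auto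
    then have p3: "p^3 \<le> C^3 * s^3" by (simp add: power_mult_distrib)
    have "\<bar>sin p - p\<bar> \<le> p^3/6"
      using sin_quintic_bounds(1)[of p] sin_x_le_x[of p] p by auto
    then have sp: "\<bar>sin p - p\<bar> \<le> C^3 * s^3 / 6" using p3 by linarith
    have "\<bar>(a + e) * (sin p - p)\<bar> = (a + e) * \<bar>sin p - p\<bar>" using a e by (simp add: abs_mult)
    also have "\<dots> \<le> (a + 1) * (C^3 * s^3 / 6)" using a e sp by (intro mult_mono) auto
    finally have 2: "\<bar>(a + e) * (sin p - p)\<bar> \<le> (a + 1) * (C^3 * s^3 / 6)" .
    have "e * p \<le> e * (C * s)" using e pC by (intro mult_left_mono) auto
    then have 3: "\<bar>e * p\<bar> \<le> C * s^3" using e p s by (simp add: power2_eq_square power3_eq_cube mult_ac)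
    have "\<bar>a * (p - sqrt (q * e))\<bar> \<le> a * (M / sqrt q * s^3)"
      using a 1 unfolding abs_mult by (intro mult_mono) auto
    \<comment> \<open>The three summands are the error of \<open>sin p\<close> against
      \<open>p\<close>, the shift of the prefactor from \<open>a\<close> to \<open>a + e\<close>,
      and the error of \<open>\<Psi>\<close> itself. Each is \<open>O(s^3)\<close>, and their
      constants add up to \<open>C2\<close>.\<close>
    moreover have "(a + e) * sin p - a * sqrt (q * e) = (a + e) * (sin p - p) + e * p + a * (p - sqrt (q * e))"
      by (simp add: algebra_simps)
    ultimately have "\<bar>(a + e) * sin p - a * sqrt (q * e)\<bar>
        \<le> (a + 1) * (C^3 * s^3 / 6) + C * s^3 + a * (M / sqrt q * s^3)"
      using 2 3 by linarith
    also have "\<dots> = C2 * s^3"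
      by (simp add: C1_def C2_def algebra_simps)
    finally show ?case using 1 unfolding b s3 p_def[symmetric] C1_def by simp
  qed
  show ?thesis
    unfolding q_sqrt unfolding a_def[symmetric]
  proof
    show "(\<lambda>\<epsilon>. \<Psi> (a + \<epsilon>) - sqrt (q * \<epsilon>)) \<in> O[at_right 0](\<lambda>\<epsilon>. \<epsilon> powr (3/2))"
      using est by (intro bigoI[where c = C1]) (auto elim!: eventually_mono)
    show "(\<lambda>\<epsilon>. \<beta> (a + \<epsilon>) - a * sqrt (q * \<epsilon>)) \<in> O[at_right 0](\<lambda>\<epsilon>. \<epsilon> powr (3/2))"
      using est by (intro bigoI[where c = C2]) (auto elim!: eventually_mono)
  qed
qed

end
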